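(* Let $f$ be an automorphism of the infinite Johnson graph $J_{\infty}$ and let $C$ be a connected component of $J_{\infty}$. Then there exists a regular automorphism $g$ of $J_{\infty}$ such that $f(X)=g(X)$ for every vertex $X\in C$.
   Context: The infinite Johnson graph $J_{\infty}$ is the simple graph whose vertices are all subsets $X\subset\mathbb{N}$ with $|X|=|\mathbb{N}\setminus X|=\infty$; two vertices $X,Y$ are adjacent if $|X\setminus Y|=|Y\setminus X|=1$. This graph is not connected. Every permutation $s$ of $\mathbb{N}$ induces an automorphism $X\mapsto s(X)=\{s(x):x\in X\}$ of $J_{\infty}$, and $*:X\mapsto\mathbb{N}\setminus X$ is also an automorphism of $J_{\infty}$. An automorphism of $J_{\infty}$ is called regular if it is induced by a permutation of $\mathbb{N}$ or it is the composition of $*$ and the automorphism induced by a permutation of $\mathbb{N}$. *)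

theory Defs
  imports Main
begin

(* A simple graph is given by its vertex set V and its edge relation E, a symmetric
   irreflexive relation on V. *)

definition simple_graph :: "'a set \<Rightarrow> 'a rel \<Rightarrow> bool" where
  "simple_graph V E \<longleftrightarrow> E \<subseteq> V \<times> V \<and> sym E \<and> irrefl E"

(* Only the values on V matter; the function is unconstrained elsewhere. *)
definition graph_automorphism :: "'a set \<Rightarrow> 'a rel \<Rightarrow> ('a \<Rightarrow> 'a) \<Rightarrow> bool" where
  "graph_automorphism V E f \<longleftrightarrow>
     bij_betw f V V \<and> (\<forall>x\<in>V. \<forall>y\<in>V. (f x, f y) \<in> E \<longleftrightarrow> (x, y) \<in> E)"

(* Vertex sets of the components: E is symmetric and contained in V \<times> V, so E\<^sup>* restricts
   to an equivalence relation on V, "joined by a finite path", and no class leaves V. *)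
definition connected_components :: "'a set \<Rightarrow> 'a rel \<Rightarrow> 'a set set" where
  "connected_components V E = V // E\<^sup>*"

definition johnson_verts :: "nat set set" where
  "johnson_verts = {X. infinite X \<and> infinite (UNIV - X)}"

(* card A = 1 forces A to be finite, since card is 0 on infinite sets. *)
definition johnson_edges :: "nat set rel" where
  "johnson_edges = {(X, Y). X \<in> johnson_verts \<and> Y \<in> johnson_verts \<and>
     card (X - Y) = 1 \<and> card (Y - X) = 1}"

abbreviation johnson_automorphism :: "(nat set \<Rightarrow> nat set) \<Rightarrow> bool" where
  "johnson_automorphism \<equiv> graph_automorphism johnson_verts johnson_edges"

definition star :: "nat set \<Rightarrow> nat set" where
  "star X = UNIV - X"

(* The order of composition is immaterial, as star (s ` X) = s ` star X for bijective s. *)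
definition regular_automorphism :: "(nat set \<Rightarrow> nat set) \<Rightarrow> bool" where
  "regular_automorphism g \<longleftrightarrow> johnson_automorphism g \<and>
     (\<exists>s :: nat \<Rightarrow> nat. bij s \<and>
        ((\<forall>X\<in>johnson_verts. g X = s ` X) \<or>
         (\<forall>X\<in>johnson_verts. g X = star (s ` X))))"

lemma simple_graph_johnson: "simple_graph johnson_verts johnson_edges"
  by (auto simp: simple_graph_def johnson_edges_def sym_def irrefl_def)

lemma star_star [simp]: "star (star X) = X"
  by (auto simp: star_def)

lemma star_image: "bij s \<Longrightarrow> star (s ` X) = s ` star X"
  by (auto simp: star_def bij_image_Compl_eq simp flip: Compl_eq_Diff_UNIV)

lemma star_in_johnson_verts [simp]: "star X \<in> johnson_verts \<longleftrightarrow> X \<in> johnson_verts"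
  by (auto simp: johnson_verts_def star_def double_diff)

lemma image_in_johnson_verts:
  assumes "bij s"
  shows "s ` X \<in> johnson_verts \<longleftrightarrow> X \<in> johnson_verts"
  using star_image[OF assms, of X] bij_is_inj[OF assms]
  by (simp add: johnson_verts_def star_def finite_image_iff inj_on_subset)

lemma johnson_automorphism_image:
  assumes "bij s"
  shows "johnson_automorphism ((`) s)"
proof -
  have "bij_betw ((`) s) johnson_verts johnson_verts"
  proof (rule bij_betw_byWitness[where f' = "(`) (inv s)"])
    show "\<forall>X\<in>johnson_verts. inv s ` s ` X = X"
      using assms by (simp add: bij_is_inj image_inv_f_f)
    show "\<forall>X\<in>johnson_verts. s ` inv s ` X = X"
      using assms by (simp add: bij_is_surj image_f_inv_f)
  qed (use assms in \<open>auto simp: image_in_johnson_verts bij_imp_bij_inv\<close>)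
  moreover have "card (s ` X - s ` Y) = card (X - Y)" for X Y
    using bij_is_inj[OF assms] by (metis card_image image_set_diff inj_on_subset subset_UNIV)
  ultimately show ?thesis
    using assms by (simp add: graph_automorphism_def johnson_edges_def image_in_johnson_verts)
qed

lemma johnson_automorphism_star: "johnson_automorphism star"
proof -
  have "bij_betw star johnson_verts johnson_verts"
    by (rule bij_betw_byWitness[where f' = star]) auto
  moreover have "star X - star Y = Y - X" for X Y
    by (auto simp: star_def)
  ultimately show ?thesis
    by (auto simp: graph_automorphism_def johnson_edges_def)
qed

end

theory Submission
  imports Defs
begin

text \<open>
  The neighbours of a vertex \<open>X\<close> arise by exchanging some \<open>a \<in> X\<close> for some \<open>b \<notin> X\<close>, so they
  correspond to the cells \<open>(a, b)\<close> of the grid \<open>X \<times> -X\<close>; two of them are adjacent iff the cells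
  lie on a common row or column. The proof combines two facts about such grids.

  An isomorphism between two grids sends rows to rows and columns to columns, or it interchanges
  the two families (\<open>grid_isomorphism_cases\<close>). An automorphism \<open>f\<close> induces an isomorphism from
  the grid of \<open>X\<close> to that of \<open>f X\<close>. If rows go to rows, the two coordinate bijections
  \<open>X \<rightarrow> f X\<close> and \<open>-X \<rightarrow> - f X\<close> glue to a permutation \<open>s\<close> of the ground set, and \<open>f\<close> agrees with
  the image map of \<open>s\<close> on \<open>X\<close> and on all its neighbours; if they are interchanged, the same
  happens after taking complements. So some regular automorphism \<open>g\<close> agrees with \<open>f\<close> on a ball of
  radius one (\<open>regular_automorphism_on_ball\<close>).

  Two cells that share neither row nor column have only two common neighbours in the grid, the
  remaining corners of the rectangle that they span (\<open>two_common_neighbours\<close>). If \<open>f\<close> and \<open>g\<close> agree on \<open>X\<close> and on its neighbours,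
  then around a neighbour \<open>Y\<close> they agree on the row and the column through the cell of \<open>X\<close>. Every
  other cell of the grid of \<open>Y\<close> is the corner opposite to \<open>X\<close> of a rectangle whose other two
  corners lie on that cross, so they agree there too (\<open>agreement_at_neighbour\<close>). Agreement on one
  ball therefore spreads along paths to the whole component.
\<close>

section \<open>Isomorphisms of grids\<close>

definition collinear :: "'a \<times> 'b \<Rightarrow> 'a \<times> 'b \<Rightarrow> bool" where
  "collinear u v \<longleftrightarrow> u \<noteq> v \<and> (fst u = fst v \<or> snd u = snd v)"

lemma collinear_swap [simp]: "collinear (prod.swap u) (prod.swap v) \<longleftrightarrow> collinear u v"
  by (auto simp: collinear_def prod_eq_iff)

text \<open>Once a row lands in a row, the cells of the other rows must stay outside the image row,
  because each is collinear with only one cell of the original row. The image of such a cell can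
  then only share its column with the image of its projection to the original row.\<close>

lemma column_determined_by_row:
  assumes inj: "inj_on p (A \<times> B)"
    and col: "\<And>u v. u \<in> A \<times> B \<Longrightarrow> v \<in> A \<times> B \<Longrightarrow> collinear (p u) (p v) \<longleftrightarrow> collinear u v"
    and two: "b1 \<in> B" "b2 \<in> B" "b1 \<noteq> b2"
    and a0: "a0 \<in> A"
    and row: "\<And>b. b \<in> B \<Longrightarrow> fst (p (a0, b)) = y"
    and ab: "a \<in> A" "b \<in> B"
  shows "snd (p (a, b)) = snd (p (a0, b))"
proof (cases "a = a0")
  case False
  obtain b' where b': "b' \<in> B" "b' \<noteq> b"
    using two by metis
  have "\<not> collinear (a, b) (a0, b')" "collinear (a, b) (a0, b)" "(a, b) \<noteq> (a0, b')"
    using False b' by (auto simp: collinear_def)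
  then have nc: "\<not> collinear (p (a, b)) (p (a0, b'))" and c: "collinear (p (a, b)) (p (a0, b))"
    using col a0 ab b' by auto
  have "collinear (p (a0, b)) (p (a0, b'))"
    using col[of "(a0, b)" "(a0, b')"] a0 ab b' by (auto simp: collinear_def)
  moreover have "p (a, b) \<noteq> p (a0, b')"
    using inj_onD[OF inj, of "(a, b)" "(a0, b')"] False a0 ab b' by auto
  ultimately show ?thesis
    using nc c row[OF b'(1)] row[OF ab(2)] by (auto simp: collinear_def)
qed simp

lemma product_map_if_row_to_row:
  assumes p: "bij_betw p (A \<times> B) (A' \<times> B')"
    and col: "\<And>u v. u \<in> A \<times> B \<Longrightarrow> v \<in> A \<times> B \<Longrightarrow> collinear (p u) (p v) \<longleftrightarrow> collinear u v"
    and A: "a0 \<in> A" "a1 \<in> A" "a0 \<noteq> a1"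
    and B: "b0 \<in> B" "b1 \<in> B" "b0 \<noteq> b1"
    and row: "\<And>b. b \<in> B \<Longrightarrow> fst (p (a0, b)) = y"
  shows "\<exists>\<sigma> \<tau>. bij_betw \<sigma> A A' \<and> bij_betw \<tau> B B' \<and>
           (\<forall>a\<in>A. \<forall>b\<in>B. p (a, b) = (\<sigma> a, \<tau> b))"
proof -
  have inj: "inj_on p (A \<times> B)" and im: "p ` (A \<times> B) = A' \<times> B'"
    using p by (auto simp: bij_betw_def)
  define \<sigma> where "\<sigma> a = fst (p (a, b0))" for a
  define \<tau> where "\<tau> b = snd (p (a0, b))" for b
  have snd_p: "snd (p (a, b)) = \<tau> b" if "a \<in> A" "b \<in> B" for a b
    unfolding \<tau>_def by (rule column_determined_by_row[OF inj col B A(1) row that])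
  \<comment> \<open>Hence the column of \<open>b0\<close> lands in a column, and the transposed grids satisfy the
      hypotheses of the same lemma.\<close>
  have fst_p: "fst (p (a, b)) = \<sigma> a" if "a \<in> A" "b \<in> B" for a b
  proof -
    have "snd ((prod.swap \<circ> p \<circ> prod.swap) (b, a)) = snd ((prod.swap \<circ> p \<circ> prod.swap) (b0, a))"
    proof (rule column_determined_by_row[OF _ _ A B(1) _ that(2,1)])
      have "inj_on p (prod.swap ` (B \<times> A))"
        using inj by (simp add: product_swap)
      then show "inj_on (prod.swap \<circ> p \<circ> prod.swap) (B \<times> A)"
        by (intro comp_inj_on) (auto simp: inj_on_subset[OF inj_swap])
    next
      show "fst ((prod.swap \<circ> p \<circ> prod.swap) (b0, a)) = \<tau> b0" if "a \<in> A" for a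
        using snd_p[OF that B(1)] by simp
    next
      fix u v :: "'b \<times> 'a"
      assume "u \<in> B \<times> A" "v \<in> B \<times> A"
      then have "collinear (p (prod.swap u)) (p (prod.swap v)) \<longleftrightarrow>
          collinear (prod.swap u) (prod.swap v)"
        by (intro col) auto
      then show "collinear ((prod.swap \<circ> p \<circ> prod.swap) u) ((prod.swap \<circ> p \<circ> prod.swap) v) \<longleftrightarrow>
          collinear u v"
        by simp
    qed
    then show ?thesis
      by (simp add: \<sigma>_def)
  qed
  have p_eq: "p (a, b) = (\<sigma> a, \<tau> b)" if "a \<in> A" "b \<in> B" for a b
    using fst_p[OF that] snd_p[OF that] by (metis prod.collapse)
  have "p ` (A \<times> B) = \<sigma> ` A \<times> \<tau> ` B"
    using p_eq by force
  then have "\<sigma> ` A \<times> \<tau> ` B = A' \<times> B'"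
    using im by simp
  then have "\<sigma> ` A = A'" "\<tau> ` B = B'"
    using A(1) B(1) by (auto simp: times_eq_iff)
  moreover have "inj_on \<sigma> A"
  proof (rule inj_onI)
    fix a a' assume "a \<in> A" "a' \<in> A" "\<sigma> a = \<sigma> a'"
    then have "p (a, b0) = p (a', b0)"
      using p_eq B(1) by simp
    then show "a = a'"
      using inj_onD[OF inj] \<open>a \<in> A\<close> \<open>a' \<in> A\<close> B(1) by blast
  qed
  moreover have "inj_on \<tau> B"
  proof (rule inj_onI)
    fix b b' assume "b \<in> B" "b' \<in> B" "\<tau> b = \<tau> b'"
    then have "p (a0, b) = p (a0, b')"
      using p_eq A(1) by simp
    then show "b = b'"
      using inj_onD[OF inj] \<open>b \<in> B\<close> \<open>b' \<in> B\<close> A(1) by blast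
  qed
  ultimately show ?thesis
    using p_eq by (auto simp: bij_betw_def)
qed

text \<open>Three pairwise collinear cells lie on one line. The images of two cells of a row therefore
  decide whether the whole row lands in a row or in a column, and transposing the target reduces
  the second case to the first.\<close>

lemma grid_isomorphism_cases:
  fixes p :: "'a \<times> 'b \<Rightarrow> 'c \<times> 'd"
  assumes p: "bij_betw p (A \<times> B) (A' \<times> B')"
    and col: "\<And>u v. u \<in> A \<times> B \<Longrightarrow> v \<in> A \<times> B \<Longrightarrow> collinear (p u) (p v) \<longleftrightarrow> collinear u v"
    and A: "a0 \<in> A" "a1 \<in> A" "a0 \<noteq> a1"
    and B: "b0 \<in> B" "b1 \<in> B" "b0 \<noteq> b1"
  obtains
    (straight) \<sigma> \<tau> where "bij_betw \<sigma> A A'" "bij_betw \<tau> B B'"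
      "\<And>a b. a \<in> A \<Longrightarrow> b \<in> B \<Longrightarrow> p (a, b) = (\<sigma> a, \<tau> b)"
  | (crossed) \<sigma> \<tau> where "bij_betw \<sigma> A B'" "bij_betw \<tau> B A'"
      "\<And>a b. a \<in> A \<Longrightarrow> b \<in> B \<Longrightarrow> p (a, b) = (\<tau> b, \<sigma> a)"
proof -
  have row: "collinear (p (a0, b)) (p (a0, b'))" if "b \<in> B" "b' \<in> B" "b \<noteq> b'" for b b'
    using col[of "(a0, b)" "(a0, b')"] A(1) that by (auto simp: collinear_def)
  consider (fst) "fst (p (a0, b0)) = fst (p (a0, b1))" | (snd) "snd (p (a0, b0)) = snd (p (a0, b1))"
    using row[OF B] by (auto simp: collinear_def)
  then show thesis
  proof cases
    case fst
    have "fst (p (a0, b)) = fst (p (a0, b0))" if "b \<in> B" for b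
    proof (cases "b = b0 \<or> b = b1")
      case False
      then show ?thesis
        using row[OF B] row[OF that B(1)] row[OF that B(2)] fst
        by (auto simp: collinear_def prod_eq_iff)
    qed (use fst in auto)
    from product_map_if_row_to_row[OF p col A B this]
    show thesis
      using straight by blast
  next
    case snd
    have "snd (p (a0, b)) = snd (p (a0, b0))" if "b \<in> B" for b
    proof (cases "b = b0 \<or> b = b1")
      case False
      then show ?thesis
        using row[OF B] row[OF that B(1)] row[OF that B(2)] snd
        by (auto simp: collinear_def prod_eq_iff)
    qed (use snd in auto)
    then have row': "\<And>b. b \<in> B \<Longrightarrow> fst ((prod.swap \<circ> p) (a0, b)) = snd (p (a0, b0))"
      by simp
    have p': "bij_betw (prod.swap \<circ> p) (A \<times> B) (B' \<times> A')"
      by (rule bij_betw_trans[OF p]) (auto simp: bij_betw_def)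
    have col': "collinear ((prod.swap \<circ> p) u) ((prod.swap \<circ> p) v) \<longleftrightarrow> collinear u v"
      if "u \<in> A \<times> B" "v \<in> A \<times> B" for u v
      using col[OF that] by simp
    obtain \<sigma> \<tau> where st: "bij_betw \<sigma> A B'" "bij_betw \<tau> B A'"
      "\<forall>a\<in>A. \<forall>b\<in>B. (prod.swap \<circ> p) (a, b) = (\<sigma> a, \<tau> b)"
      using product_map_if_row_to_row[OF p' col' A B row'] by blast
    have "p (a, b) = (\<tau> b, \<sigma> a)" if "a \<in> A" "b \<in> B" for a b
      using st(3) that by (metis comp_apply swap_simp swap_swap)
    with st(1,2) show thesis
      using crossed by blast
  qed
qed

section \<open>The neighbours of a vertex form a grid\<close>

definition exchange :: "'a set \<Rightarrow> 'a \<times> 'a \<Rightarrow> 'a set" where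
  "exchange X u = insert (snd u) (X - {fst u})"

lemma inj_on_exchange: "inj_on (exchange X) (X \<times> - X)"
proof (rule inj_onI)
  fix u v
  assume "u \<in> X \<times> - X" "v \<in> X \<times> - X" "exchange X u = exchange X v"
  moreover have "X - exchange X u = {fst u}" "exchange X u - X = {snd u}" if "u \<in> X \<times> - X" for u
    using that by (auto simp: exchange_def)
  ultimately have "{fst u} = {fst v}" "{snd u} = {snd v}"
    by metis+
  then show "u = v"
    by (auto simp: prod_eq_iff)
qed

lemma exchange_in_johnson_verts:
  assumes "X \<in> johnson_verts"
  shows "exchange X u \<in> johnson_verts"
proof -
  have "- X - {snd u} \<subseteq> UNIV - exchange X u"
    by (auto simp: exchange_def)
  then show ?thesis
    using assms finite_subset[of "- X - {snd u}"]
    by (auto simp: johnson_verts_def exchange_def Compl_eq_Diff_UNIV)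
qed

lemma johnson_neighbours:
  assumes "X \<in> johnson_verts"
  shows "johnson_edges `` {X} = exchange X ` (X \<times> - X)"
proof (intro equalityI subsetI)
  fix Y
  assume "Y \<in> johnson_edges `` {X}"
  then obtain a b where "X - Y = {a}" "Y - X = {b}"
    by (auto simp: johnson_edges_def card_1_singleton_iff)
  then have "Y = exchange X (a, b)" "(a, b) \<in> X \<times> - X"
    by (auto simp: exchange_def)
  then show "Y \<in> exchange X ` (X \<times> - X)"
    by blast
next
  fix Y
  assume "Y \<in> exchange X ` (X \<times> - X)"
  then obtain u where u: "u \<in> X \<times> - X" "Y = exchange X u"
    by blast
  then have "X - Y = {fst u}" "Y - X = {snd u}"
    by (auto simp: exchange_def)
  then show "Y \<in> johnson_edges `` {X}"
    using assms exchange_in_johnson_verts[OF assms, of u] u by (simp add: johnson_edges_def)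
qed

lemma exchange_adjacent_iff:
  assumes "X \<in> johnson_verts" "u \<in> X \<times> - X" "v \<in> X \<times> - X"
  shows "(exchange X u, exchange X v) \<in> johnson_edges \<longleftrightarrow> collinear u v"
proof -
  have diff: "exchange X u - exchange X v =
      (if snd u = snd v then {} else {snd u}) \<union> (if fst u = fst v then {} else {fst v})"
    if "u \<in> X \<times> - X" "v \<in> X \<times> - X" for u v
    using that by (auto simp: exchange_def)
  have "fst v \<noteq> snd u" "fst u \<noteq> snd v"
    using assms(2,3) by auto
  then show ?thesis
    using assms exchange_in_johnson_verts
    by (auto simp: johnson_edges_def collinear_def diff[OF assms(2,3)] diff[OF assms(3,2)]
        prod_eq_iff)
qed

section \<open>A regular automorphism agreeing on a ball\<close>

lemma johnson_automorphism_verts: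
  assumes "johnson_automorphism f" "X \<in> johnson_verts"
  shows "f X \<in> johnson_verts"
  using assms by (auto simp: graph_automorphism_def bij_betw_def)

lemma johnson_edges_verts:
  "(X, Y) \<in> johnson_edges \<Longrightarrow> X \<in> johnson_verts"
  "(X, Y) \<in> johnson_edges \<Longrightarrow> Y \<in> johnson_verts"
  by (auto simp: johnson_edges_def)

lemma johnson_edges_sym: "(X, Y) \<in> johnson_edges \<Longrightarrow> (Y, X) \<in> johnson_edges"
  by (auto simp: johnson_edges_def)

lemma johnson_automorphism_edge:
  assumes "johnson_automorphism f" "(X, Y) \<in> johnson_edges"
  shows "(f X, f Y) \<in> johnson_edges"
  using assms johnson_edges_verts[OF assms(2)] by (auto simp: graph_automorphism_def)

lemma johnson_automorphism_neighbours:
  assumes f: "johnson_automorphism f" and X: "X \<in> johnson_verts"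
  shows "bij_betw f (johnson_edges `` {X}) (johnson_edges `` {f X})"
proof -
  have inj: "inj_on f johnson_verts" and surj: "f ` johnson_verts = johnson_verts"
    and iff: "\<And>Y. Y \<in> johnson_verts \<Longrightarrow> (f X, f Y) \<in> johnson_edges \<longleftrightarrow> (X, Y) \<in> johnson_edges"
    using f X by (auto simp: graph_automorphism_def bij_betw_def)
  have "f ` (johnson_edges `` {X}) = johnson_edges `` {f X}"
  proof (intro equalityI subsetI)
    fix Z
    assume Z: "Z \<in> johnson_edges `` {f X}"
    then obtain Y where "Y \<in> johnson_verts" "Z = f Y"
      using surj johnson_edges_verts(2) by blast
    with Z iff show "Z \<in> f ` (johnson_edges `` {X})"
      by auto
  qed (use johnson_automorphism_edge[OF f] in auto)
  moreover have "inj_on f (johnson_edges `` {X})"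
    using inj by (rule inj_on_subset) (auto dest: johnson_edges_verts)
  ultimately show ?thesis
    by (simp add: bij_betw_def)
qed

lemma regular_automorphism_image: "bij s \<Longrightarrow> regular_automorphism ((`) s)"
  by (auto simp: regular_automorphism_def johnson_automorphism_image)

lemma regular_automorphism_star_image:
  assumes "bij s"
  shows "regular_automorphism (\<lambda>X. star (s ` X))"
proof -
  have "johnson_automorphism (star \<circ> (`) s)"
    using johnson_automorphism_image[OF assms] johnson_automorphism_star
    by (auto simp: graph_automorphism_def image_in_johnson_verts[OF assms]
        intro: bij_betw_trans)
  then show ?thesis
    using assms by (auto simp: regular_automorphism_def comp_def)
qed

lemma glue_bijections:
  assumes "bij_betw \<sigma> X Y" "bij_betw \<tau> (- X) (- Y)"
  obtains s where "bij s" "s ` X = Y"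
    "\<And>u. u \<in> X \<times> - X \<Longrightarrow> s ` exchange X u = exchange Y (\<sigma> (fst u), \<tau> (snd u))"
proof -
  define s where "s x = (if x \<in> X then \<sigma> x else \<tau> x)" for x
  have sX: "bij_betw s X Y"
    using assms(1) by (subst bij_betw_cong[of _ _ \<sigma>]) (auto simp: s_def)
  have sC: "bij_betw s (- X) (- Y)"
    using assms(2) by (subst bij_betw_cong[of _ _ \<tau>]) (auto simp: s_def)
  have bij: "bij s"
    using bij_betw_combine[OF sX sC] by simp
  have "s ` exchange X u = exchange (s ` X) (s (fst u), s (snd u))" for u
    using bij_is_inj[OF bij] by (auto simp: exchange_def image_set_diff)
  then show thesis
    using bij sX by (intro that[of s]) (auto simp: s_def bij_betw_def)
qed

lemma star_exchange:
  "u \<in> Y \<times> - Y \<Longrightarrow> star (exchange (- Y) (prod.swap u)) = exchange Y u"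
  by (auto simp: star_def exchange_def)

text \<open>Read in grid coordinates at \<open>X\<close> and \<open>f X\<close>, the automorphism \<open>f\<close> becomes a grid isomorphism
  \<open>p\<close>. In the crossed case its coordinate maps go \<open>X \<rightarrow> - f X\<close> and \<open>-X \<rightarrow> f X\<close>, so they glue to a
  permutation that describes \<open>star \<circ> f\<close>.\<close>

lemma regular_automorphism_on_ball:
  assumes f: "johnson_automorphism f" and X: "X \<in> johnson_verts"
  obtains g where "regular_automorphism g" "f X = g X"
    "\<And>Y. (X, Y) \<in> johnson_edges \<Longrightarrow> f Y = g Y"
proof -
  note result = that
  note fX = johnson_automorphism_verts[OF f X]
  define p where "p = inv_into (f X \<times> - f X) (exchange (f X)) \<circ> (f \<circ> exchange X)"
  have grid: "bij_betw (exchange Z) (Z \<times> - Z) (johnson_edges `` {Z})"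
    if "Z \<in> johnson_verts" for Z
    using inj_on_exchange[of Z] johnson_neighbours[OF that] by (simp add: bij_betw_def)
  have f_ex: "bij_betw (f \<circ> exchange X) (X \<times> - X) (johnson_edges `` {f X})"
    by (rule bij_betw_trans[OF grid[OF X] johnson_automorphism_neighbours[OF f X]])
  have p: "bij_betw p (X \<times> - X) (f X \<times> - f X)"
    unfolding p_def by (rule bij_betw_trans[OF f_ex bij_betw_inv_into[OF grid[OF fX]]])
  have ex_p: "exchange (f X) (p u) = f (exchange X u)" if "u \<in> X \<times> - X" for u
    using bij_betw_inv_into_right[OF grid[OF fX]] bij_betw_apply[OF f_ex that]
    by (simp add: p_def)
  have col: "collinear (p u) (p v) \<longleftrightarrow> collinear u v" if "u \<in> X \<times> - X" "v \<in> X \<times> - X" for u v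
  proof -
    have "collinear (p u) (p v) \<longleftrightarrow> (f (exchange X u), f (exchange X v)) \<in> johnson_edges"
      using exchange_adjacent_iff[OF fX] bij_betw_apply[OF p] that ex_p by metis
    also have "\<dots> \<longleftrightarrow> (exchange X u, exchange X v) \<in> johnson_edges"
      using f exchange_in_johnson_verts[OF X] by (simp add: graph_automorphism_def)
    also have "\<dots> \<longleftrightarrow> collinear u v"
      by (rule exchange_adjacent_iff[OF X that])
    finally show ?thesis .
  qed
  have two: "\<exists>x y. x \<in> Z \<and> y \<in> Z \<and> x \<noteq> y" if "infinite Z" for Z :: "nat set"
    using that by (metis finite.simps insertI1 subsetI finite_subset singletonI)
  obtain a0 a1 where A: "a0 \<in> X" "a1 \<in> X" "a0 \<noteq> a1"
    using two[of X] X by (auto simp: johnson_verts_def)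
  obtain b0 b1 where B: "b0 \<in> - X" "b1 \<in> - X" "b0 \<noteq> b1"
    using two[of "- X"] X by (auto simp: johnson_verts_def Compl_eq_Diff_UNIV)
  have agree: thesis if g: "regular_automorphism g" "f X = g X"
    and ex: "\<And>u. u \<in> X \<times> - X \<Longrightarrow> f (exchange X u) = g (exchange X u)" for g
  proof (rule result[OF g])
    fix Y
    assume "(X, Y) \<in> johnson_edges"
    then obtain u where "u \<in> X \<times> - X" "Y = exchange X u"
      using johnson_neighbours[OF X] by blast
    then show "f Y = g Y"
      using ex by simp
  qed
  show thesis
  proof (rule grid_isomorphism_cases[OF p col A B])
    fix \<sigma> \<tau>
    assume straight: "bij_betw \<sigma> X (f X)" "bij_betw \<tau> (- X) (- f X)"
      "\<And>a b. a \<in> X \<Longrightarrow> b \<in> - X \<Longrightarrow> p (a, b) = (\<sigma> a, \<tau> b)"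
    obtain s where s: "bij s" "s ` X = f X"
      "\<And>u. u \<in> X \<times> - X \<Longrightarrow> s ` exchange X u = exchange (f X) (\<sigma> (fst u), \<tau> (snd u))"
      using glue_bijections[OF straight(1,2)] by metis
    show thesis
    proof (rule agree[OF regular_automorphism_image[OF s(1)]])
      fix u
      assume u: "u \<in> X \<times> - X"
      then have "p u = (\<sigma> (fst u), \<tau> (snd u))"
        using straight(3)[of "fst u" "snd u"] by auto
      then show "f (exchange X u) = s ` exchange X u"
        using s(3)[OF u] ex_p[OF u] by simp
    qed (use s in simp)
  next
    fix \<sigma> \<tau>
    assume crossed: "bij_betw \<sigma> X (- f X)" "bij_betw \<tau> (- X) (f X)"
      "\<And>a b. a \<in> X \<Longrightarrow> b \<in> - X \<Longrightarrow> p (a, b) = (\<tau> b, \<sigma> a)"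
    have "bij_betw \<tau> (- X) (- (- f X))"
      using crossed(2) by simp
    then obtain s where s: "bij s" "s ` X = - f X"
      "\<And>u. u \<in> X \<times> - X \<Longrightarrow> s ` exchange X u = exchange (- f X) (\<sigma> (fst u), \<tau> (snd u))"
      using glue_bijections[OF crossed(1)] by metis
    show thesis
    proof (rule agree[OF regular_automorphism_star_image[OF s(1)]])
      fix u
      assume u: "u \<in> X \<times> - X"
      then have "p u = (\<tau> (snd u), \<sigma> (fst u))"
        using crossed(3)[of "fst u" "snd u"] by auto
      then show "f (exchange X u) = star (s ` exchange X u)"
        using s(3)[OF u] ex_p[OF u] star_exchange[OF bij_betw_apply[OF p u]] by simp
    qed (use s in \<open>auto simp: star_def\<close>)
  qed
qed

section \<open>Agreement spreads along edges\<close>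

text \<open>Phrased without coordinates, so that it can be applied to images under two automorphisms \<open>f\<close>
  and \<open>g\<close>: \<open>P\<close> will be the common image of a vertex where they agree, and \<open>Q\<close> and \<open>R\<close> the images
  under \<open>f\<close> and \<open>g\<close> of the opposite corner. In the grid of \<open>Y\<close>, all three lie among the two corners
  that complete \<open>U\<close> and \<open>V\<close> to a rectangle.\<close>

lemma two_common_neighbours:
  assumes Y: "(Y, U) \<in> johnson_edges" "(Y, V) \<in> johnson_edges"
    and UV: "U \<noteq> V" "(U, V) \<notin> johnson_edges"
    and P: "(Y, P) \<in> johnson_edges" "(U, P) \<in> johnson_edges" "(V, P) \<in> johnson_edges"
    and Q: "(Y, Q) \<in> johnson_edges" "(U, Q) \<in> johnson_edges" "(V, Q) \<in> johnson_edges"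
    and R: "(Y, R) \<in> johnson_edges" "(U, R) \<in> johnson_edges" "(V, R) \<in> johnson_edges"
    and PQ: "P \<noteq> Q" and PR: "P \<noteq> R"
  shows "Q = R"
proof -
  note YV = johnson_edges_verts(1)[OF Y(1)]
  have cell: "\<exists>z. Z = exchange Y z \<and> z \<in> Y \<times> - Y" if "(Y, Z) \<in> johnson_edges" for Z
    using that johnson_neighbours[OF YV] by blast
  obtain u v p q r where
    eq: "U = exchange Y u" "V = exchange Y v" "P = exchange Y p" "Q = exchange Y q"
      "R = exchange Y r"
    and mem: "u \<in> Y \<times> - Y" "v \<in> Y \<times> - Y" "p \<in> Y \<times> - Y" "q \<in> Y \<times> - Y" "r \<in> Y \<times> - Y"
    using cell[OF Y(1)] cell[OF Y(2)] cell[OF P(1)] cell[OF Q(1)] cell[OF R(1)] by metis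
  have uv: "u \<noteq> v" "\<not> collinear u v"
    using UV eq exchange_adjacent_iff[OF YV mem(1,2)] by auto
  have corner: "z = (fst u, snd v) \<or> z = (fst v, snd u)"
    if "z \<in> Y \<times> - Y" "(U, exchange Y z) \<in> johnson_edges" "(V, exchange Y z) \<in> johnson_edges" for z
  proof -
    have "collinear u z" "collinear v z"
      using that eq exchange_adjacent_iff[OF YV] mem by auto
    with uv show ?thesis
      by (auto simp: collinear_def prod_eq_iff)
  qed
  have "p \<noteq> q" "p \<noteq> r"
    using PQ PR eq by auto
  then have "q = r"
    using corner[OF mem(3)] corner[OF mem(4)] corner[OF mem(5)] P Q R eq by metis
  with eq show ?thesis
    by simp
qed

text \<open>The radius-one balls around \<open>X\<close> and \<open>Y\<close> share the row and the column through the cell of \<open>X\<close>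
  in the grid of \<open>Y\<close>. A cell \<open>w\<close> off this cross is determined by its two projections to the cross:
  it is their common neighbour other than the cell of \<open>X\<close>.\<close>

lemma agreement_at_neighbour:
  assumes f: "johnson_automorphism f" and g: "johnson_automorphism g"
    and X: "f X = g X" "\<And>Z. (X, Z) \<in> johnson_edges \<Longrightarrow> f Z = g Z"
    and XY: "(X, Y) \<in> johnson_edges" and YW: "(Y, W) \<in> johnson_edges"
  shows "f W = g W"
proof -
  note YV = johnson_edges_verts(2)[OF XY]
  have YX: "(Y, X) \<in> johnson_edges"
    using XY by (rule johnson_edges_sym)
  obtain x where x: "X = exchange Y x" "x \<in> Y \<times> - Y"
    using YX johnson_neighbours[OF YV] by blast
  obtain w where w: "W = exchange Y w" "w \<in> Y \<times> - Y"
    using YW johnson_neighbours[OF YV] by blast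
  consider (same) "x = w" | (line) "collinear x w" | (rectangle) "fst x \<noteq> fst w" "snd x \<noteq> snd w"
    unfolding collinear_def by blast
  then show ?thesis
  proof cases
    case same
    then show ?thesis
      using X(1) x(1) w(1) by simp
  next
    case line
    then have "(X, W) \<in> johnson_edges"
      unfolding x(1) w(1) by (simp only: exchange_adjacent_iff[OF YV x(2) w(2)])
    then show ?thesis
      by (rule X(2))
  next
    case rectangle
    define u where "u = (fst x, snd w)"
    define v where "v = (fst w, snd x)"
    have mem: "u \<in> Y \<times> - Y" "v \<in> Y \<times> - Y"
      using x(2) w(2) by (auto simp: u_def v_def)
    have uv: "collinear u x" "collinear v x" "collinear u w" "collinear v w"
        "collinear x u" "collinear x v" "\<not> collinear u v" "u \<noteq> v"
      using rectangle by (auto simp: u_def v_def collinear_def prod_eq_iff)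
    let ?U = "exchange Y u" and ?V = "exchange Y v"
    have edges: "(Y, ?U) \<in> johnson_edges" "(Y, ?V) \<in> johnson_edges"
        "(?U, X) \<in> johnson_edges" "(?V, X) \<in> johnson_edges"
        "(?U, W) \<in> johnson_edges" "(?V, W) \<in> johnson_edges"
        "(X, ?U) \<in> johnson_edges" "(X, ?V) \<in> johnson_edges" "(?U, ?V) \<notin> johnson_edges"
      using uv mem johnson_neighbours[OF YV]
      unfolding x(1) w(1) by (auto simp only: exchange_adjacent_iff[OF YV] x(2) w(2))
    have eqs: "f Y = g Y" "f ?U = g ?U" "f ?V = g ?V"
      using X(2) XY edges(7,8) by auto
    have "?U \<noteq> ?V"
      using inj_onD[OF inj_on_exchange _ mem] uv(8) by blast
    moreover have "X \<noteq> W"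
      using inj_onD[OF inj_on_exchange _ x(2) w(2)] rectangle x(1) w(1) by blast
    moreover note verts = johnson_edges_verts(1)[OF XY] johnson_edges_verts(2)[OF YW]
      johnson_edges_verts(2)[OF edges(1)] johnson_edges_verts(2)[OF edges(2)]
    ultimately have ne: "f ?U \<noteq> f ?V" "f X \<noteq> f W" "f X \<noteq> g W" "(f ?U, f ?V) \<notin> johnson_edges"
      using f g X(1) edges(9) by (auto simp: graph_automorphism_def bij_betw_def inj_on_eq_iff)
    note fe = johnson_automorphism_edge[OF f] and ge = johnson_automorphism_edge[OF g]
    show ?thesis
    proof (rule two_common_neighbours[OF fe[OF edges(1)] fe[OF edges(2)] ne(1,4)
          fe[OF YX] fe[OF edges(3)] fe[OF edges(4)] fe[OF YW] fe[OF edges(5)] fe[OF edges(6)]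
          _ _ _ ne(2,3)])
      show "(f Y, g W) \<in> johnson_edges" "(f ?U, g W) \<in> johnson_edges" "(f ?V, g W) \<in> johnson_edges"
        unfolding eqs by (rule ge[OF YW] ge[OF edges(5)] ge[OF edges(6)])+
    qed
  qed
qed

theorem theorem1:
  fixes f :: "nat set \<Rightarrow> nat set" and C :: "nat set set"
  assumes "johnson_automorphism f"
    and "C \<in> connected_components johnson_verts johnson_edges"
  shows "\<exists>g. regular_automorphism g \<and> (\<forall>X\<in>C. f X = g X)"
proof -
  obtain X0 where X0: "X0 \<in> johnson_verts" "C = johnson_edges\<^sup>* `` {X0}"
    using assms(2) by (auto simp: connected_components_def elim: quotientE)
  obtain g where g: "regular_automorphism g" "f X0 = g X0"
    "\<And>Y. (X0, Y) \<in> johnson_edges \<Longrightarrow> f Y = g Y"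
    using regular_automorphism_on_ball[OF assms(1) X0(1)] by blast
  have g_aut: "johnson_automorphism g"
    using g(1) by (simp add: regular_automorphism_def)
  have "f X = g X \<and> (\<forall>Y. (X, Y) \<in> johnson_edges \<longrightarrow> f Y = g Y)"
    if "(X0, X) \<in> johnson_edges\<^sup>*" for X
    using that
  proof (induction rule: rtrancl_induct)
    case base
    then show ?case
      using g by blast
  next
    case (step X Y)
    then show ?case
      using agreement_at_neighbour[OF assms(1) g_aut] by blast
  qed
  then show ?thesis
    using g(1) X0(2) by blast
qed

end
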